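(* Let $A,B\subset\mathcal{E}$ be closed and nonempty, let $\lambda\in(0,1)$, and let $\bar x\in \operatorname{Fix}T_{\mathrm{DR}\lambda}\neq\emptyset$. Let $\bar b\in P_B(\bar x)$ and $\bar a\in P_A(2\bar b-\bar x)$. Suppose that $B$ is super-regular at a distance relative to $\Lambda_{\bar b}:=P_B^{-1}(\bar b)$ at $\bar b$ and that $A$ is super-regular at a distance relative to $\Lambda_{\bar a}:=P_A^{-1}(\bar a)$ at $\bar a$, and that the corresponding neighborhoods $U_\epsilon(\bar b)$ of $\bar b$ and $U_\epsilon(\bar a)$ of $\bar a$ ($\epsilon>0$) satisfy the following. (i) For each $\epsilon>0$, $\bar x\in U_\epsilon(\bar b)$, where $U_\epsilon(\bar b)$ is a neighborhood of $\bar b$ on which the regularity inequality (SR) holds for $\Omega=B$, $\Lambda=\Lambda_{\bar b}$ with constant $\epsilon$. (ii) For each $\epsilon>0$, $2\bar b-\bar x\in U_\epsilon(\bar a)$, where $U_\epsilon(\bar a)$ is a neighborhood of $\bar a$ on which (SR) holds for $\Omega=A$, $\Lambda=\Lambda_{\bar a}$ with constant $\epsilon$. (iii) $R_B(\Lambda_{\bar b})\subset\Lambda_{\bar a}$. (iv) $R_B(U_\epsilon(\bar b))\subset U_\epsilon(\bar a)$ for all $\epsilon>0$. Then $\{\bar b\}=P_B(\bar x)$, $\{\bar a\}=P_A(R_B(\bar x))$, $T_{\mathrm{DR}\lambda}$ is single-valued at $\bar x$, and for every $\epsilon>0$ there exists a neighborhood $U(B,\epsilon,\bar x)$ of $\bar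 b$ such that $T_{\mathrm{DR}\lambda}$ is pointwise almost firmly nonexpansive at $\bar x$ with violation at most $\epsilon$ on $U(B,\epsilon,\bar x)$.
   Context: $\mathcal{E}$ is a finite-dimensional Euclidean space. For $C\subset\mathcal{E}$: $\operatorname{dist}(x,C)=\inf_{y\in C}\|x-y\|$; the projector is the set-valued map $P_C(x)=\{z\in C:\|z-x\|=\operatorname{dist}(x,C)\}$; $P_C^{-1}(z)=\{x: z\in P_C(x)\}$; the reflector is $R_C(x)=2P_C(x)-x$ (set-valued); for a set $D$, $R_C(D)=\bigcup_{x\in D}R_C(x)$. The proximal normal cone at $x\in C$ is $N_C^{\mathrm P}(x)=\operatorname{cone}(P_C^{-1}(x)-x)$ (empty if $x\notin C$). Relaxed Douglas–Rachford mapping: $T_{\mathrm{DR}\lambda}(x)=\left\{\tfrac{\lambda}{2}\big(R_A(2b-x)+x\big)+(1-\lambda)b : b\in P_B(x)\right\}$, a set-valued map ($R_A(2b-x)$ ranges over all its elements). $\operatorname{Fix}T=\{x: x\in T(x)\}$. "Single-valued at $x$" means $T(x)$ is a singleton. Regularity. For $\Omega,\Lambda\subset\mathcal{E}$, $\epsilon>0$ and a set $U\subset\mathcal{E}$, put $V=\{(x,v)\in\operatorname{gph}N_\Omega^{\mathrm P}: x+v\in U,\ x\in P_\Omega(x+v)\}$. The regularity inequality (SR) holds on $U$ with constant $\epsilon$ if $$\langle v-(y'-y),\,y-x\rangle\le\epsilon\,\|v-(y'-y)\|\,\|y-x\|\qquad\forall (x,v)\in V,\ \forall y'\in\Lambda\cap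 U,\ \forall y\in P_\Omega(y').$$ $\Omega$ is $\epsilon$-super-regular at a distance relative to $\Lambda$ at $\bar\omega$ if it is locally closed at $\bar\omega$ and there is a neighborhood $U_\epsilon$ of $\bar\omega$ (with $U_\epsilon\cap\Lambda\ne\emptyset$) on which (SR) holds with constant $\epsilon$; it is super-regular at a distance relative to $\Lambda$ at $\bar\omega$ if this is so for every $\epsilon>0$. Almost firm nonexpansiveness. $T:D\rightrightarrows\mathcal{E}$ is pointwise almost nonexpansive at $y\in D$ on $D$ with violation $\epsilon$ if $\|x^+-y^+\|\le\sqrt{1+\epsilon}\,\|x-y\|$ for all $x\in D$, $x^+\in T(x)$, $y^+\in T(y)$. $T$ is pointwise almost averaged at $y$ on $D$ with averaging constant $\alpha\in(0,1)$ and violation $\epsilon$ if $\tfrac1\alpha T+\tfrac{\alpha-1}{\alpha}\mathrm{Id}$ is pointwise almost nonexpansive at $y$ on $D$ with violation $\epsilon/\alpha$; equivalently $\|x^+-y^+\|^2\le(1+\epsilon)\|x-y\|^2-\tfrac{1-\alpha}{\alpha}\|(x-x^+)-(y-y^+)\|^2$ for all $x\in D$, $x^+\in T(x)$, $y^+\in T(y)$. Pointwise almost firmly nonexpansive means pointwise almost averaged with $\alpha=1/2$. (In particular the set on which the property is asserted contains the reference point $y$.) *)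

theory Defs
  imports "HOL-Analysis.Analysis"
begin

text \<open>
  Set-valued maps on a Euclidean space are rendered as functions from points to sets.
  The Euclidean space itself is an arbitrary type of class \<open>euclidean_space\<close>.
\<close>

definition graph_sv :: "('a \<Rightarrow> 'b set) \<Rightarrow> ('a \<times> 'b) set" where
  "graph_sv F = {(x, v). v \<in> F x}"

definition image_sv :: "('a \<Rightarrow> 'b set) \<Rightarrow> 'a set \<Rightarrow> 'b set" where
  "image_sv F D = (\<Union>x\<in>D. F x)"

definition Fix_sv :: "('a \<Rightarrow> 'a set) \<Rightarrow> 'a set" where
  "Fix_sv T = {x. x \<in> T x}"

definition projector :: "'a::euclidean_space set \<Rightarrow> 'a \<Rightarrow> 'a set" where
  "projector C x = {z \<in> C. norm (z - x) = infdist x C}"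

definition projector_inv :: "'a::euclidean_space set \<Rightarrow> 'a \<Rightarrow> 'a set" where
  "projector_inv C z = {x. z \<in> projector C x}"

definition reflector :: "'a::euclidean_space set \<Rightarrow> 'a \<Rightarrow> 'a set" where
  "reflector C x = {2 *\<^sub>R z - x | z. z \<in> projector C x}"

text \<open>
  The hull of the empty set is empty, so the proximal normal cone is empty
  at points outside \<open>C\<close>.
\<close>

definition prox_normal_cone :: "'a::euclidean_space set \<Rightarrow> 'a \<Rightarrow> 'a set" where
  "prox_normal_cone C x = cone hull {w - x | w. w \<in> projector_inv C x}"

text \<open>Relaxed Douglas--Rachford mapping.\<close>

definition T_DR :: "'a::euclidean_space set \<Rightarrow> 'a set \<Rightarrow> real \<Rightarrow> 'a \<Rightarrow> 'a set" where
  "T_DR A B lam x =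
     {(lam / 2) *\<^sub>R (r + x) + (1 - lam) *\<^sub>R b | b r.
        b \<in> projector B x \<and> r \<in> reflector A (2 *\<^sub>R b - x)}"

definition locally_closed_at :: "'a::euclidean_space set \<Rightarrow> 'a \<Rightarrow> bool" where
  "locally_closed_at \<Omega> \<omega> \<longleftrightarrow> (\<exists>r>0. closed (\<Omega> \<inter> cball \<omega> r))"

definition SR_ineq :: "'a::euclidean_space set \<Rightarrow> 'a set \<Rightarrow> real \<Rightarrow> 'a set \<Rightarrow> bool" where
  "SR_ineq \<Omega> \<Lambda> \<epsilon> U \<longleftrightarrow>
     (\<forall>(x, v) \<in> {(x, v) \<in> graph_sv (prox_normal_cone \<Omega>). x + v \<in> U \<and> x \<in> projector \<Omega> (x + v)}.
        \<forall>y' \<in> \<Lambda> \<inter> U. \<forall>y \<in> projector \<Omega> y'.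
          (v - (y' - y)) \<bullet> (y - x) \<le> \<epsilon> * norm (v - (y' - y)) * norm (y - x))"

text \<open>
  Neighborhoods need not be open: \<open>U\<close> is a neighborhood of \<open>\<omega>\<close> iff
  \<open>\<omega> \<in> interior U\<close>.
\<close>

definition SR_neighborhood ::
    "'a::euclidean_space set \<Rightarrow> 'a set \<Rightarrow> 'a \<Rightarrow> real \<Rightarrow> 'a set \<Rightarrow> bool" where
  "SR_neighborhood \<Omega> \<Lambda> \<omega> \<epsilon> U \<longleftrightarrow>
     \<omega> \<in> interior U \<and> U \<inter> \<Lambda> \<noteq> {} \<and> SR_ineq \<Omega> \<Lambda> \<epsilon> U"

definition eps_super_regular_at_distance ::
    "real \<Rightarrow> 'a::euclidean_space set \<Rightarrow> 'a set \<Rightarrow> 'a \<Rightarrow> bool" where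
  "eps_super_regular_at_distance \<epsilon> \<Omega> \<Lambda> \<omega> \<longleftrightarrow>
     locally_closed_at \<Omega> \<omega> \<and> (\<exists>U. SR_neighborhood \<Omega> \<Lambda> \<omega> \<epsilon> U)"

definition super_regular_at_distance ::
    "'a::euclidean_space set \<Rightarrow> 'a set \<Rightarrow> 'a \<Rightarrow> bool" where
  "super_regular_at_distance \<Omega> \<Lambda> \<omega> \<longleftrightarrow>
     (\<forall>\<epsilon>>0. eps_super_regular_at_distance \<epsilon> \<Omega> \<Lambda> \<omega>)"

text \<open>
  In the following three notions the reference point \<open>y\<close> belongs to the set \<open>D\<close>
  on which the property is asserted.
\<close>

definition pt_almost_nonexpansive ::
    "('a::euclidean_space \<Rightarrow> 'a set) \<Rightarrow> 'a set \<Rightarrow> 'a \<Rightarrow> real \<Rightarrow> bool" where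
  "pt_almost_nonexpansive T D y \<epsilon> \<longleftrightarrow>
     y \<in> D \<and>
     (\<forall>x\<in>D. \<forall>x\<^sub>p \<in> T x. \<forall>y\<^sub>p \<in> T y. norm (x\<^sub>p - y\<^sub>p) \<le> sqrt (1 + \<epsilon>) * norm (x - y))"

definition pt_almost_averaged ::
    "('a::euclidean_space \<Rightarrow> 'a set) \<Rightarrow> 'a set \<Rightarrow> 'a \<Rightarrow> real \<Rightarrow> real \<Rightarrow> bool" where
  "pt_almost_averaged T D y \<alpha> \<epsilon> \<longleftrightarrow>
     0 < \<alpha> \<and> \<alpha> < 1 \<and>
     pt_almost_nonexpansive
       (\<lambda>x. {(1 / \<alpha>) *\<^sub>R u + ((\<alpha> - 1) / \<alpha>) *\<^sub>R x | u. u \<in> T x}) D y (\<epsilon> / \<alpha>)"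

definition pt_almost_firmly_nonexpansive ::
    "('a::euclidean_space \<Rightarrow> 'a set) \<Rightarrow> 'a set \<Rightarrow> 'a \<Rightarrow> real \<Rightarrow> bool" where
  "pt_almost_firmly_nonexpansive T D y \<epsilon> \<longleftrightarrow> pt_almost_averaged T D y (1 / 2) \<epsilon>"

end

theory Submission
  imports Defs
begin

text \<open>
  For \<open>\<xi> = w - y\<close> and \<open>\<beta>\<close> the difference of the projections of \<open>w\<close> and \<open>y\<close>, the
  reflections differ by \<open>2 \<beta> - \<xi>\<close>, and (SR) says that
  \<open>\<parallel>2 \<beta> - \<xi>\<parallel>\<^sup>2 \<le> \<parallel>\<xi>\<parallel>\<^sup>2 + 4 \<epsilon> \<parallel>\<xi> - \<beta>\<parallel> \<parallel>\<beta>\<parallel>\<close>. By the parallelogram identity the error term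
  is at most \<open>\<epsilon> (\<parallel>\<xi>\<parallel>\<^sup>2 + \<parallel>2 \<beta> - \<xi>\<parallel>\<^sup>2)\<close>, so reflecting expands squared distances to
  \<open>y\<close> by at most the factor \<open>q = (1 + \<epsilon>) / (1 - \<epsilon>)\<close>. The case \<open>w = y\<close> shows that the
  projector is single-valued at \<open>y\<close>. Since \<open>2 T - Id\<close> is the convex combination
  \<open>\<lambda> R\<^sub>A R\<^sub>B + (1 - \<lambda>) R\<^sub>B\<close>, it expands distances to \<open>xbar\<close> by at most \<open>q\<close>, and \<open>q\<close> tends
  to 1 with \<open>\<epsilon>\<close>.
\<close>

text \<open>The difference \<open>w - z\<close> is a generator of the proximal normal cone at
  \<open>z\<close>, so (SR) can be read as a statement about points of \<open>U\<close> and their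
  projections alone.\<close>

lemma SR_ineqD:
  assumes "SR_ineq \<Omega> \<Lambda> \<epsilon> U" "w \<in> U" "z \<in> projector \<Omega> w"
    and "y \<in> \<Lambda>" "y \<in> U" "p \<in> projector \<Omega> y"
  shows "((w - z) - (y - p)) \<bullet> (p - z) \<le> \<epsilon> * norm ((w - z) - (y - p)) * norm (p - z)"
proof -
  have "w - z \<in> prox_normal_cone \<Omega> z"
    unfolding prox_normal_cone_def projector_inv_def
    using assms(3) by (intro hull_inc) blast
  then have "(z, w - z) \<in> {(x, v) \<in> graph_sv (prox_normal_cone \<Omega>).
      x + v \<in> U \<and> x \<in> projector \<Omega> (x + v)}"
    using assms(2,3) by (simp add: graph_sv_def)
  then show ?thesis
    using assms(1,4-6) unfolding SR_ineq_def by blast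
qed

lemma reflection_bound:
  fixes \<xi> \<beta> :: "'a::real_inner"
  assumes "0 \<le> \<epsilon>" "(\<xi> - \<beta>) \<bullet> (- \<beta>) \<le> \<epsilon> * norm (\<xi> - \<beta>) * norm \<beta>"
  shows "(1 - \<epsilon>) * (norm (2 *\<^sub>R \<beta> - \<xi>))\<^sup>2 \<le> (1 + \<epsilon>) * (norm \<xi>)\<^sup>2"
proof -
  have parallelogram:
    "(norm \<xi>)\<^sup>2 + (norm (2 *\<^sub>R \<beta> - \<xi>))\<^sup>2 = 2 * ((norm (\<xi> - \<beta>))\<^sup>2 + (norm \<beta>)\<^sup>2)"
    by (simp add: power2_norm_eq_inner inner_diff inner_commute algebra_simps)
  have "2 * (norm (\<xi> - \<beta>) * norm \<beta>) \<le> (norm (\<xi> - \<beta>))\<^sup>2 + (norm \<beta>)\<^sup>2"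
    using sum_squares_bound[of "norm (\<xi> - \<beta>)" "norm \<beta>"] by (simp add: mult.assoc)
  then have "4 * (norm (\<xi> - \<beta>) * norm \<beta>) \<le> (norm \<xi>)\<^sup>2 + (norm (2 *\<^sub>R \<beta> - \<xi>))\<^sup>2"
    unfolding parallelogram by simp
  from mult_left_mono[OF this assms(1)]
  have "4 * (\<epsilon> * norm (\<xi> - \<beta>) * norm \<beta>) \<le> \<epsilon> * ((norm \<xi>)\<^sup>2 + (norm (2 *\<^sub>R \<beta> - \<xi>))\<^sup>2)"
    by (simp add: mult_ac)
  moreover have "(norm (2 *\<^sub>R \<beta> - \<xi>))\<^sup>2 = (norm \<xi>)\<^sup>2 + 4 * ((\<xi> - \<beta>) \<bullet> (- \<beta>))"
    by (simp add: power2_norm_eq_inner inner_diff inner_commute algebra_simps)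
  ultimately show ?thesis
    using assms(2) unfolding left_diff_distrib distrib_right distrib_left by argo
qed

lemma SR_reflector_bound:
  assumes "0 \<le> \<epsilon>" "SR_ineq \<Omega> \<Lambda> \<epsilon> U" "w \<in> U" "z \<in> projector \<Omega> w"
    and "y \<in> \<Lambda>" "y \<in> U" "p \<in> projector \<Omega> y"
  shows "(1 - \<epsilon>) * (norm ((2 *\<^sub>R z - w) - (2 *\<^sub>R p - y)))\<^sup>2 \<le> (1 + \<epsilon>) * (norm (w - y))\<^sup>2"
proof -
  have "((w - y) - (z - p)) \<bullet> (- (z - p)) \<le> \<epsilon> * norm ((w - y) - (z - p)) * norm (z - p)"
    using SR_ineqD[OF assms(2-7)] by (simp add: algebra_simps norm_minus_commute)
  from reflection_bound[OF assms(1) this] show ?thesis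
    by (simp add: algebra_simps)
qed

lemma SR_projector_unique:
  assumes "0 \<le> \<epsilon>" "\<epsilon> < 1" "SR_ineq \<Omega> \<Lambda> \<epsilon> U" "y \<in> \<Lambda>" "y \<in> U"
    and "p \<in> projector \<Omega> y"
  shows "projector \<Omega> y = {p}"
proof -
  have "z = p" if "z \<in> projector \<Omega> y" for z
  proof -
    have "(1 - \<epsilon>) * (norm (2 *\<^sub>R z - 2 *\<^sub>R p))\<^sup>2 \<le> 0"
      using SR_reflector_bound[OF assms(1,3,5) that assms(4-6)] by simp
    then show ?thesis
      using assms(2) by (simp add: mult_le_0_iff)
  qed
  then show ?thesis
    using assms(6) by blast
qed

theorem theorem3p7:
  fixes A B :: "'a::euclidean_space set"
    and lam :: real
    and xbar abar bbar :: 'a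
    and Ua Ub :: "real \<Rightarrow> 'a set"
  assumes "closed A" "A \<noteq> {}" "closed B" "B \<noteq> {}"
    and "0 < lam" "lam < 1"
    and "xbar \<in> Fix_sv (T_DR A B lam)"
    and "bbar \<in> projector B xbar"
    and "abar \<in> projector A (2 *\<^sub>R bbar - xbar)"
    and "super_regular_at_distance B (projector_inv B bbar) bbar"
    and "super_regular_at_distance A (projector_inv A abar) abar"
    and "\<And>\<epsilon>. \<epsilon> > 0 \<Longrightarrow>
           SR_neighborhood B (projector_inv B bbar) bbar \<epsilon> (Ub \<epsilon>) \<and> xbar \<in> Ub \<epsilon>"
    and "\<And>\<epsilon>. \<epsilon> > 0 \<Longrightarrow>
           SR_neighborhood A (projector_inv A abar) abar \<epsilon> (Ua \<epsilon>) \<and> 2 *\<^sub>R bbar - xbar \<in> Ua \<epsilon>"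
    and "image_sv (reflector B) (projector_inv B bbar) \<subseteq> projector_inv A abar"
    and "\<And>\<epsilon>. \<epsilon> > 0 \<Longrightarrow> image_sv (reflector B) (Ub \<epsilon>) \<subseteq> Ua \<epsilon>"
  shows "{bbar} = projector B xbar
       \<and> {abar} = image_sv (projector A) (reflector B xbar)
       \<and> is_singleton (T_DR A B lam xbar)
       \<and> (\<forall>\<epsilon>>0. \<exists>U. bbar \<in> interior U \<and>
            (\<exists>\<epsilon>'. 0 \<le> \<epsilon>' \<and> \<epsilon>' \<le> \<epsilon> \<and>
               pt_almost_firmly_nonexpansive (T_DR A B lam) U xbar \<epsilon>'))"
proof (intro conjI allI impI)
  have SR_B: "SR_ineq B (projector_inv B bbar) \<delta> (Ub \<delta>)" "xbar \<in> Ub \<delta>" "bbar \<in> interior (Ub \<delta>)"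
    and SR_A: "SR_ineq A (projector_inv A abar) \<delta> (Ua \<delta>)" "2 *\<^sub>R bbar - xbar \<in> Ua \<delta>"
    if "\<delta> > 0" for \<delta>
    using assms(12,13)[OF that] by (auto simp: SR_neighborhood_def)
  have xbar_in: "xbar \<in> projector_inv B bbar"
    and ybar_in: "2 *\<^sub>R bbar - xbar \<in> projector_inv A abar"
    using assms(8,9) by (simp_all add: projector_inv_def)
  \<comment> \<open>Any constant strictly between 0 and 1 would serve, as every neighborhood
    \<open>Ub \<epsilon>\<close> contains \<open>xbar\<close>.\<close>
  have PB: "projector B xbar = {bbar}"
    using SR_projector_unique[OF _ _ SR_B(1) xbar_in SR_B(2) assms(8), of "1/2"] by simp
  have PA: "projector A (2 *\<^sub>R bbar - xbar) = {abar}"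
    using SR_projector_unique[OF _ _ SR_A(1) ybar_in SR_A(2) assms(9), of "1/2"] by simp
  show "{bbar} = projector B xbar"
    using PB by simp
  show "{abar} = image_sv (projector A) (reflector B xbar)"
    using PA by (simp add: image_sv_def reflector_def PB)
  have T_xbar: "T_DR A B lam xbar =
      {(lam / 2) *\<^sub>R ((2 *\<^sub>R abar - (2 *\<^sub>R bbar - xbar)) + xbar) + (1 - lam) *\<^sub>R bbar}"
    by (simp add: T_DR_def reflector_def PB PA)
  then show "is_singleton (T_DR A B lam xbar)"
    by simp
  fix \<epsilon> :: real
  assume "\<epsilon> > 0"
  \<comment> \<open>For averaging constant 1/2 the violation is doubled on passing to
    \<open>2 T - Id\<close>, so \<open>q\<close> is exactly the expansion factor allowed there. The
    choice of \<open>\<delta>\<close> solves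
    \<open>(1 + \<delta>) / (1 - \<delta>) = q\<close>.\<close>
  define q where "q = sqrt (1 + 2 * \<epsilon>)"
  define \<delta> where "\<delta> = (q - 1) / (q + 1)"
  have q: "q > 1"
    using \<open>\<epsilon> > 0\<close> by (simp add: q_def)
  then have \<delta>: "\<delta> > 0" "\<delta> < 1" "1 + \<delta> = q * (1 - \<delta>)"
    by (simp_all add: \<delta>_def field_simps)
  have le_q: "s \<le> q * t" if "(1 - \<delta>) * s \<le> (1 + \<delta>) * t" for s t
  proof -
    have "(1 - \<delta>) * s \<le> (1 - \<delta>) * (q * t)"
      using that \<delta>(3) by (simp add: mult_ac)
    then show ?thesis
      using \<delta>(2) by simp
  qed
  have "norm ((2 *\<^sub>R u - x) - (2 *\<^sub>R v - xbar)) \<le> q * norm (x - xbar)"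
    if "x \<in> Ub \<delta>" "u \<in> T_DR A B lam x" "v \<in> T_DR A B lam xbar" for x u v
  proof -
    obtain a b where b: "b \<in> projector B x" and a: "a \<in> projector A (2 *\<^sub>R b - x)"
      and u: "u = (lam / 2) *\<^sub>R ((2 *\<^sub>R a - (2 *\<^sub>R b - x)) + x) + (1 - lam) *\<^sub>R b"
      using \<open>u \<in> _\<close> by (auto simp: T_DR_def reflector_def)
    \<comment> \<open>Differences of the values at \<open>x\<close> and \<open>xbar\<close>:
      \<open>?\<rho>\<close> after reflecting in \<open>B\<close>, \<open>?\<sigma>\<close> after
      reflecting that result in \<open>A\<close>.\<close>
    let ?\<rho> = "(2 *\<^sub>R b - x) - (2 *\<^sub>R bbar - xbar)"
    let ?\<sigma> = "(2 *\<^sub>R a - (2 *\<^sub>R b - x)) - (2 *\<^sub>R abar - (2 *\<^sub>R bbar - xbar))"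
    \<comment> \<open>Hypothesis (iv) carries \<open>x\<close> into the region where (SR) for
      \<open>A\<close> holds with the same \<open>\<delta>\<close>.\<close>
    have "2 *\<^sub>R b - x \<in> Ua \<delta>"
      using assms(15)[OF \<delta>(1)] \<open>x \<in> Ub \<delta>\<close> b by (auto simp: image_sv_def reflector_def)
    then have \<sigma>: "(norm ?\<sigma>)\<^sup>2 \<le> q * (norm ?\<rho>)\<^sup>2"
      using SR_reflector_bound[OF _ SR_A(1) _ a ybar_in SR_A(2) assms(9)] \<delta>(1)
      by (intro le_q) simp
    have \<rho>: "(norm ?\<rho>)\<^sup>2 \<le> q * (norm (x - xbar))\<^sup>2"
      using SR_reflector_bound[OF _ SR_B(1) \<open>x \<in> Ub \<delta>\<close> b xbar_in SR_B(2) assms(8)] \<delta>(1)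
      by (intro le_q) simp
    \<comment> \<open>Each reflection costs a factor \<open>q\<close> on squared norms; the two
      together cost \<open>q\<close> on norms.\<close>
    have "(norm ?\<sigma>)\<^sup>2 \<le> (q * norm (x - xbar))\<^sup>2"
      using order_trans[OF \<sigma> mult_left_mono[OF \<rho>]] q
      by (simp add: power_mult_distrib power2_eq_square[of q] mult.assoc)
    then have \<sigma>': "norm ?\<sigma> \<le> q * norm (x - xbar)"
      using q by (auto intro: power2_le_imp_le)
    \<comment> \<open>A single reflection costs only the square root of \<open>q\<close> on norms.
      As \<open>q > 1\<close>, this is weakened to \<open>q\<close>, so that one bound serves both
      terms of the convex combination.\<close>
    have "q * (norm (x - xbar))\<^sup>2 \<le> (q * norm (x - xbar))\<^sup>2"
      using q mult_right_mono[of 1 q "q * (norm (x - xbar))\<^sup>2"]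
      by (simp add: power_mult_distrib power2_eq_square[of q] mult.assoc)
    then have \<rho>': "norm ?\<rho> \<le> q * norm (x - xbar)"
      using q by (intro power2_le_imp_le[OF order_trans[OF \<rho>]]) auto
    have v: "v = (lam / 2) *\<^sub>R ((2 *\<^sub>R abar - (2 *\<^sub>R bbar - xbar)) + xbar) + (1 - lam) *\<^sub>R bbar"
      using \<open>v \<in> _\<close> T_xbar by simp
    have "(lam * 2) *\<^sub>R y = lam *\<^sub>R y + lam *\<^sub>R y" for y :: 'a
      by (simp flip: scaleR_add_left)
    then have "(2 *\<^sub>R u - x) - (2 *\<^sub>R v - xbar) = lam *\<^sub>R ?\<sigma> + (1 - lam) *\<^sub>R ?\<rho>"
      by (simp add: u v algebra_simps)
    then have "norm ((2 *\<^sub>R u - x) - (2 *\<^sub>R v - xbar)) \<le> lam * norm ?\<sigma> + (1 - lam) * norm ?\<rho>"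
      using norm_triangle_ineq[of "lam *\<^sub>R ?\<sigma>" "(1 - lam) *\<^sub>R ?\<rho>"] assms(5,6) by simp
    also have "\<dots> \<le> q * norm (x - xbar)"
      using assms(5,6) by (intro convex_bound_le \<sigma>' \<rho>') auto
    finally show ?thesis .
  qed
  \<comment> \<open>The violation attained is \<open>\<epsilon>\<close> itself, since the square of
    \<open>q\<close> is \<open>1 + \<epsilon> / (1/2)\<close>.\<close>
  then have "pt_almost_firmly_nonexpansive (T_DR A B lam) (Ub \<delta>) xbar \<epsilon>"
    using SR_B(2)[OF \<delta>(1)]
    by (auto simp: pt_almost_firmly_nonexpansive_def pt_almost_averaged_def
        pt_almost_nonexpansive_def q_def mult.commute)
  then show "\<exists>U. bbar \<in> interior U \<and> (\<exists>\<epsilon>'. 0 \<le> \<epsilon>' \<and> \<epsilon>' \<le> \<epsilon> \<and>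
      pt_almost_firmly_nonexpansive (T_DR A B lam) U xbar \<epsilon>')"
    using SR_B(3)[OF \<delta>(1)] \<open>\<epsilon> > 0\<close> by (meson less_imp_le order_refl)
qed

end
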